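(* Let $\Phi\subset\mathbb{R}^d$ be a lattice such that $H\subseteq G_\Phi$, where $H$ is the group generated by the coordinate reflections, and suppose $F:\mathbb{R}^d\to(-\infty,\infty]$ is $S_\Phi$-invariant. Let $a_1\mathbb{Z}\times\cdots\times a_d\mathbb{Z}$ ($a_i>0$) be a rectangular sublattice of $\Phi$ (one exists), with associated change of variables $T=T_{a_1,\dots,a_d}$ and associated polynomials $P_v^\Phi$, $v\in\Phi^*$. Suppose $(c_v)_{v\in W_\Phi}$ is a family of real numbers such that (a) $c_v\ge0$ for all nonzero $v\in W_\Phi$; (b) $\sum_{v\in W_\Phi}c_v<\infty$; and (c) the continuous function $$\tilde g:=c_0+\sum_{v\in W_\Phi\setminus\{0\}}c_vP_v^\Phi$$ satisfies $\tilde g\le\tilde F$ on $\tilde\Delta_\Phi=T(\Delta_\Phi)$. Let $g=\tilde g\circ T$. Then for any $n$-point configuration $\omega_n=\{x_1,\dots,x_n\}\subset\mathbb{R}^d$, $$E_F(\omega_n)\ \ge\ E_g(\omega_n)\ \ge\ n^2c_0-n\,\tilde g(1,\dots,1),$$ and equality holds throughout if and only if both: (1) $\tilde g(t)=\tilde F(t)$ for all $t\in T(\{x_i-x_j: i\ne j\in\{1,\dots,n\}\})$; and (2) $c_vM_{\sigma v}(\omega_n)=0$ for all nonzero $v\in W_\Phi$ and all $\sigma\in G_\Phi$.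
   Context: A lattice is $\Phi=V\mathbb{Z}^d$, $V$ nonsingular; $\Phi^*=\{v: w\cdot v\in\mathbb{Z}\ \forall w\in\Phi\}$. $S_\Phi$ is the group of isometries of $\mathbb{R}^d$ mapping $\Phi$ onto itself, and $G_\Phi\subset O(d)$ is its subgroup fixing the origin. $H$ is the group of order $2^d$ generated by the reflections $R_j(x_1,\dots,x_j,\dots,x_d)=(x_1,\dots,-x_j,\dots,x_d)$, $j=1,\dots,d$. $W_\Phi$ denotes a choice of fundamental domain for $\Phi^*/G_\Phi$ (exactly one point from each $G_\Phi$-orbit in $\Phi^*$), and $\Delta_\Phi$ a choice of fundamental domain for $\mathbb{R}^d/S_\Phi$. Any lattice $\Phi$ with $H\subseteq G_\Phi$ contains a rectangular lattice $a_1\mathbb{Z}\times\cdots\times a_d\mathbb{Z}$. The associated change of variables is $T_{a_1,\dots,a_d}(x_1,\dots,x_d)=(\cos(2\pi x_1/a_1),\dots,\cos(2\pi x_d/a_d))\in[-1,1]^d$. For a function $h$ on $\mathbb{R}^d$ that is $(a_1\mathbb{Z}\times\cdots\times a_d\mathbb{Z})$-periodic and $H$-invariant, $\tilde h:[-1,1]^d\to(-\infty,\infty]$ (or $\mathbb{C}$) is $\tilde h(t)=h\big(\tfrac{a_1\arccos t_1}{2\pi},\dots,\tfrac{a_d\arccos t_d}{2\pi}\big)$, so that $\tilde h(T(x))=h(x)$. For $v\in\Phi^*$ let $C_v(x)=\frac1{|G_\Phi|}\sum_{\sigma\in G_\Phi}e^{2\pi i(\sigma v)\cdot x}$, and let $P_v^\Phi=\tilde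 C_v$, which is a polynomial in $t_1,\dots,t_d$. An $n$-point configuration is a multiset of cardinality $n$ in $\mathbb{R}^d$; $E_F(\omega_n)=\sum_{i}\sum_{j\ne i}F(x_i-x_j)$, and similarly $E_g$. $M_v(\omega_n)=\sum_{x\in\omega_n}e^{2\pi i v\cdot x}$. *)

theory Defs
  imports "HOL-Analysis.Analysis"
begin

definition is_lattice :: "(real ^ 'd) set \<Rightarrow> bool" where
  "is_lattice \<Phi> \<longleftrightarrow>
     (\<exists>V :: real ^ 'd ^ 'd. invertible V \<and> \<Phi> = (\<lambda>z. V *v z) ` {z. \<forall>i. z $ i \<in> \<int>})"

definition dual_lattice :: "(real ^ 'd) set \<Rightarrow> (real ^ 'd) set" where
  "dual_lattice \<Phi> = {v. \<forall>w\<in>\<Phi>. w \<bullet> v \<in> \<int>}"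

definition lattice_isometries :: "(real ^ 'd) set \<Rightarrow> (real ^ 'd \<Rightarrow> real ^ 'd) set" where
  "lattice_isometries \<Phi> = {f. (\<forall>x y. dist (f x) (f y) = dist x y) \<and> f ` \<Phi> = \<Phi>}"

definition point_group :: "(real ^ 'd) set \<Rightarrow> (real ^ 'd \<Rightarrow> real ^ 'd) set" where
  "point_group \<Phi> = {f \<in> lattice_isometries \<Phi>. f 0 = 0}"

definition coord_reflection :: "'d \<Rightarrow> real ^ 'd \<Rightarrow> real ^ 'd" where
  "coord_reflection j x = (\<chi> i. if i = j then - x $ i else x $ i)"

inductive_set generated_group :: "('a \<Rightarrow> 'a) set \<Rightarrow> ('a \<Rightarrow> 'a) set"
  for S :: "('a \<Rightarrow> 'a) set" where
  id: "id \<in> generated_group S"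
| base: "f \<in> S \<Longrightarrow> f \<in> generated_group S"
| comp: "f \<in> generated_group S \<Longrightarrow> g \<in> generated_group S \<Longrightarrow> f \<circ> g \<in> generated_group S"
| inv: "f \<in> generated_group S \<Longrightarrow> inv f \<in> generated_group S"

definition reflection_group :: "(real ^ 'd \<Rightarrow> real ^ 'd) set" where
  "reflection_group = generated_group (range coord_reflection)"

definition fundamental_domain :: "('a \<Rightarrow> 'a) set \<Rightarrow> 'a set \<Rightarrow> 'a set \<Rightarrow> bool" where
  "fundamental_domain G X D \<longleftrightarrow>
     D \<subseteq> X \<and> (\<forall>x\<in>X. \<exists>!y. y \<in> D \<and> y \<in> (\<lambda>\<sigma>. \<sigma> x) ` G)"

definition rectangular_lattice :: "real ^ 'd \<Rightarrow> (real ^ 'd) set" where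
  "rectangular_lattice a = {x. \<forall>i. \<exists>k\<in>\<int>. x $ i = a $ i * k}"

definition change_vars :: "real ^ 'd \<Rightarrow> real ^ 'd \<Rightarrow> real ^ 'd" where
  "change_vars a x = (\<chi> i. cos (2 * pi * x $ i / a $ i))"

text \<open>\<open>pushdown a h\<close> is the function written h-tilde; only its values on \<open>[-1,1]\<^sup>d\<close> are
  meaningful.\<close>

definition pushdown :: "real ^ 'd \<Rightarrow> (real ^ 'd \<Rightarrow> 'b) \<Rightarrow> real ^ 'd \<Rightarrow> 'b" where
  "pushdown a h t = h (\<chi> i. a $ i * arccos (t $ i) / (2 * pi))"

definition sym_char :: "(real ^ 'd) set \<Rightarrow> real ^ 'd \<Rightarrow> real ^ 'd \<Rightarrow> complex" where
  "sym_char \<Phi> v x =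
     (\<Sum>\<sigma>\<in>point_group \<Phi>. exp (2 * of_real pi * \<i> * of_real (\<sigma> v \<bullet> x)))
       / of_nat (card (point_group \<Phi>))"

definition lattice_poly ::
    "(real ^ 'd) set \<Rightarrow> real ^ 'd \<Rightarrow> real ^ 'd \<Rightarrow> real ^ 'd \<Rightarrow> complex" where
  "lattice_poly \<Phi> a v = pushdown a (sym_char \<Phi> v)"

text \<open>Taking the real part below loses nothing: whenever the point group contains the
  reflection group, the values of \<^const>\<open>lattice_poly\<close> are real; this is
  \<open>lattice_poly_in_Reals\<close>.\<close>

definition poly_series ::
    "(real ^ 'd) set \<Rightarrow> real ^ 'd \<Rightarrow> (real ^ 'd) set \<Rightarrow> (real ^ 'd \<Rightarrow> real) \<Rightarrow> real ^ 'd \<Rightarrow> real" where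
  "poly_series \<Phi> a W c t =
     c 0 + (\<Sum>\<^sub>\<infinity>v\<in>W - {0}. c v * Re (lattice_poly \<Phi> a v t))"

text \<open>An \<open>n\<close>-point configuration (a multiset) is given by an enumeration
  \<open>x 1, \<dots>, x n\<close>, in which points may repeat.\<close>

definition energy :: "(real ^ 'd \<Rightarrow> 'b::comm_monoid_add) \<Rightarrow> nat \<Rightarrow> (nat \<Rightarrow> real ^ 'd) \<Rightarrow> 'b" where
  "energy f n x = (\<Sum>i\<in>{1..n}. \<Sum>j\<in>{1..n} - {i}. f (x i - x j))"

definition exp_moment :: "real ^ 'd \<Rightarrow> nat \<Rightarrow> (nat \<Rightarrow> real ^ 'd) \<Rightarrow> complex" where
  "exp_moment v n x = (\<Sum>i\<in>{1..n}. exp (2 * of_real pi * \<i> * of_real (v \<bullet> x i)))"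

lemma uminus_in_reflection_group: "(uminus :: real ^ 'd \<Rightarrow> real ^ 'd) \<in> reflection_group"
proof -
  have "(\<lambda>x :: real ^ 'd. \<chi> i. if i \<in> A then - x $ i else x $ i) \<in> reflection_group"
    if "finite A" for A :: "'d set"
    using that
  proof (induction A rule: finite_induct)
    case empty
    have "(\<lambda>x :: real ^ 'd. \<chi> i. if i \<in> {} then - x $ i else x $ i) = id"
      by (auto simp: vec_eq_iff)
    then show ?case
      by (simp add: reflection_group_def generated_group.id del: empty_iff)
  next
    case (insert j A)
    have "(\<lambda>x :: real ^ 'd. \<chi> i. if i \<in> insert j A then - x $ i else x $ i)
      = coord_reflection j \<circ> (\<lambda>x. \<chi> i. if i \<in> A then - x $ i else x $ i)"
      using insert.hyps by (auto simp: vec_eq_iff coord_reflection_def fun_eq_iff)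
    then show ?case
      using insert.IH
      by (simp add: reflection_group_def generated_group.comp generated_group.base del: insert_iff)
  qed
  from this[of UNIV] show ?thesis
    by (simp add: vec_eq_iff fun_eq_iff uminus_vec_def)
qed

lemma lattice_poly_in_Reals:
  assumes "reflection_group \<subseteq> point_group \<Phi>"
  shows "lattice_poly \<Phi> a v t \<in> \<real>"
proof -
  have neg: "uminus \<in> point_group \<Phi>"
    using assms uminus_in_reflection_group by blast
  then have im: "uminus ` \<Phi> = \<Phi>"
    by (simp add: point_group_def lattice_isometries_def)
  have cl: "uminus \<circ> \<sigma> \<in> point_group \<Phi>" if "\<sigma> \<in> point_group \<Phi>" for \<sigma>
  proof -
    have "(uminus \<circ> \<sigma>) ` \<Phi> = \<Phi>"
      using that im by (simp only: image_comp [symmetric] point_group_def lattice_isometries_def mem_Collect_eq)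
    then show ?thesis
      using that by (simp add: point_group_def lattice_isometries_def dist_minus)
  qed
  have "cnj (sym_char \<Phi> v x) = sym_char \<Phi> v x" for x
  proof -
    have "(\<Sum>\<sigma>\<in>point_group \<Phi>. cnj (exp (2 * of_real pi * \<i> * of_real (\<sigma> v \<bullet> x))))
        = (\<Sum>\<sigma>\<in>point_group \<Phi>. exp (2 * of_real pi * \<i> * of_real (\<sigma> v \<bullet> x)))"
      by (rule sum.reindex_bij_witness[where i = "\<lambda>\<sigma>. uminus \<circ> \<sigma>" and j = "\<lambda>\<sigma>. uminus \<circ> \<sigma>"])
        (auto simp: cl[unfolded comp_def] comp_def fun_eq_iff exp_cnj)
    then show ?thesis
      by (simp add: sym_char_def)
  qed
  then show ?thesis
    by (simp add: lattice_poly_def pushdown_def Reals_cnj_iff)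
qed

lemma rectangular_sublattice_exists:
  fixes \<Phi> :: "(real ^ 'd) set"
  assumes lat: "is_lattice \<Phi>" and H: "reflection_group \<subseteq> point_group \<Phi>"
  shows "\<exists>a. (\<forall>i. a $ i > 0) \<and> rectangular_lattice a \<subseteq> \<Phi>"
proof -
  obtain V :: "real ^ 'd ^ 'd" where V: "invertible V"
    and Phi: "\<Phi> = (\<lambda>z. V *v z) ` {z. \<forall>i. z $ i \<in> \<int>}"
    using lat by (auto simp: is_lattice_def)
  have zero: "0 \<in> \<Phi>"
    unfolding Phi by (rule image_eqI[of _ _ 0]) auto
  have add: "u + w \<in> \<Phi>" if uw: "u \<in> \<Phi>" "w \<in> \<Phi>" for u w
  proof -
    obtain y z where "u = V *v y" "w = V *v z" "\<forall>i. y $ i \<in> \<int>" "\<forall>i. z $ i \<in> \<int>"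
      using uw Phi by auto
    then show ?thesis
      unfolding Phi by (intro image_eqI[of _ _ "y + z"]) (auto simp: matrix_vector_right_distrib)
  qed
  have scale: "k *\<^sub>R u \<in> \<Phi>" if u: "u \<in> \<Phi>" "k \<in> \<int>" for u and k :: real
  proof -
    obtain y where "u = V *v y" "\<forall>i. y $ i \<in> \<int>"
      using u Phi by auto
    then show ?thesis
      unfolding Phi using u
      by (intro image_eqI[of _ _ "k *\<^sub>R y"]) (auto simp: matrix_vector_mult_scaleR)
  qed
  have sum: "(\<Sum>i\<in>A. f i) \<in> \<Phi>" if "\<And>i. f i \<in> \<Phi>" "finite A" for f :: "'d \<Rightarrow> real ^ 'd" and A
    using that(2) by (induction A rule: finite_induct) (auto simp: zero add that(1))
  have "\<exists>r>0. r *\<^sub>R axis j 1 \<in> \<Phi>" for j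
  proof -
    have "\<exists>w\<in>\<Phi>. w $ j \<noteq> 0"
    proof (rule ccontr)
      assume con: "\<not> (\<exists>w\<in>\<Phi>. w $ j \<noteq> 0)"
      have entry: "V $ j $ i = 0" for i
      proof -
        have "V *v axis i 1 \<in> \<Phi>"
          unfolding Phi by (rule imageI) (auto simp: axis_def)
        then show ?thesis
          using con by (auto simp: matrix_vector_mul_component inner_axis)
      qed
      obtain B where "V ** B = mat 1"
        using V by (auto simp: invertible_def)
      then have "(V ** B) $ j $ j = 1"
        by (simp add: mat_def)
      then show False
        by (simp add: matrix_matrix_mult_def entry)
    qed
    then obtain w where w: "w \<in> \<Phi>" "w $ j \<noteq> 0"
      by blast
    have "coord_reflection j \<in> reflection_group"
      by (simp add: reflection_group_def generated_group.base)
    then have "coord_reflection j ` \<Phi> = \<Phi>"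
      using H by (auto simp: point_group_def lattice_isometries_def)
    then have "coord_reflection j w \<in> \<Phi>"
      using w by blast
    then have "w + (-1) *\<^sub>R coord_reflection j w \<in> \<Phi>"
      using w by (intro add scale) auto
    also have "w + (-1) *\<^sub>R coord_reflection j w = (2 * w $ j) *\<^sub>R axis j 1"
      by (auto simp: vec_eq_iff coord_reflection_def axis_def)
    finally have *: "(2 * w $ j) *\<^sub>R axis j 1 \<in> \<Phi>" .
    then have "(-1) *\<^sub>R ((2 * w $ j) *\<^sub>R axis j 1) \<in> \<Phi>"
      by (rule scale) auto
    with * w show ?thesis
      by (cases "w $ j > 0") (auto intro: exI[of _ "2 * w $ j"] exI[of _ "- (2 * w $ j)"])
  qed
  then obtain r where r: "\<And>j. r j > 0" "\<And>j. r j *\<^sub>R axis j 1 \<in> \<Phi>"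
    by metis
  have "rectangular_lattice (\<chi> i. r i) \<subseteq> \<Phi>"
  proof
    fix x assume "x \<in> rectangular_lattice (\<chi> i. r i)"
    then obtain k where k: "\<And>i. k i \<in> \<int>" "\<And>i. x $ i = r i * k i"
      unfolding rectangular_lattice_def by simp metis
    have "x = (\<Sum>i\<in>UNIV. k i *\<^sub>R (r i *\<^sub>R axis i 1))"
      by (simp add: vec_eq_iff k axis_def if_distrib cong: if_cong)
    also have "\<dots> \<in> \<Phi>"
      by (intro sum scale r k) auto
    finally show "x \<in> \<Phi>" .
  qed
  then show ?thesis
    using r by (intro exI[of _ "\<chi> i. r i"]) auto
qed

end

theory Submission
  imports Defs
begin

text \<open>Folding a coordinate by \<open>arccos \<circ> cos\<close> amounts to a translation by a multiple of
  \<open>a\<^sub>i\<close> followed by a possible sign change. So the pushdown of a function, composed with \<open>T\<close>, is at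
  each point the function itself moved by an isometry of the lattice. Hence \<open>g\<close> is \<open>c\<^sub>0\<close> plus the
  series of the \<open>c\<^sub>v C\<^sub>v\<close>, is invariant under the isometries of the lattice, and lies below \<open>F\<close>
  everywhere. Summing \<open>C\<^sub>v\<close> over all differences of the configuration gives the average of the
  \<open>|M\<^sub>\<sigma>\<^sub>v|\<^sup>2\<close> over the point group. So the second inequality is the nonnegativity of a series,
  and it is tight iff every term vanishes.\<close>

section \<open>The lattice as a discrete additive group\<close>

lemma lattice_diff:
  fixes \<Phi> :: "(real ^ 'd) set"
  assumes "is_lattice \<Phi>" "u \<in> \<Phi>" "w \<in> \<Phi>"
  shows "u - w \<in> \<Phi>"
proof -
  obtain V :: "real ^ 'd ^ 'd" where Phi: "\<Phi> = (\<lambda>z. V *v z) ` {z. \<forall>i. z $ i \<in> \<int>}"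
    using assms(1) by (auto simp: is_lattice_def)
  obtain y z where "u = V *v y" "w = V *v z" "\<forall>i. y $ i \<in> \<int>" "\<forall>i. z $ i \<in> \<int>"
    using assms(2,3) Phi by auto
  then show ?thesis
    unfolding Phi by (intro image_eqI[of _ _ "y - z"]) (auto simp: matrix_vector_mult_diff_distrib)
qed

lemma lattice_zero:
  fixes \<Phi> :: "(real ^ 'd) set"
  assumes "is_lattice \<Phi>"
  shows "0 \<in> \<Phi>"
proof -
  obtain V :: "real ^ 'd ^ 'd" where Phi: "\<Phi> = (\<lambda>z. V *v z) ` {z. \<forall>i. z $ i \<in> \<int>}"
    using assms by (auto simp: is_lattice_def)
  show ?thesis
    unfolding Phi by (rule image_eqI[of _ _ 0]) auto
qed

lemma lattice_add:
  assumes "is_lattice \<Phi>" "u \<in> \<Phi>" "w \<in> \<Phi>"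
  shows "u + w \<in> \<Phi>"
  using lattice_diff[OF assms(1,2) lattice_diff[OF assms(1) lattice_zero[OF assms(1)] assms(3)]]
  by simp

lemma lattice_translate_image:
  assumes "is_lattice \<Phi>" "w \<in> \<Phi>"
  shows "(\<lambda>y. y - w) ` \<Phi> = \<Phi>"
proof (intro equalityI subsetI)
  fix y assume "y \<in> \<Phi>"
  then show "y \<in> (\<lambda>y. y - w) ` \<Phi>"
    using assms by (intro image_eqI[of _ _ "y + w"]) (auto intro: lattice_add)
qed (use assms lattice_diff in auto)

text \<open>The inverse of the basis matrix keeps bounded sets bounded, so the integer coordinates
  of the lattice points in \<open>S\<close> lie in a finite box.\<close>

lemma finite_lattice_Int_bounded:
  fixes \<Phi> :: "(real ^ 'd) set"
  assumes "is_lattice \<Phi>" "bounded S"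
  shows "finite (\<Phi> \<inter> S)"
proof -
  obtain V :: "real ^ 'd ^ 'd" where V: "invertible V"
    and Phi: "\<Phi> = (\<lambda>z. V *v z) ` {z. \<forall>i. z $ i \<in> \<int>}"
    using assms(1) by (auto simp: is_lattice_def)
  obtain B where B: "B ** V = mat 1"
    using V by (auto simp: invertible_def)
  have "bounded ((\<lambda>w. B *v w) ` S)"
    by (intro bounded_linear_image assms matrix_vector_mul_bounded_linear)
  then obtain K where K: "\<And>w. w \<in> S \<Longrightarrow> norm (B *v w) \<le> K"
    by (auto simp: bounded_iff)
  define Z where "Z = {z :: real ^ 'd. \<forall>i. z $ i \<in> {k \<in> \<int>. \<bar>k\<bar> \<le> K}}"
  have "finite ((\<lambda>f. \<chi> i. f i) ` (Pi UNIV (\<lambda>_ :: 'd. {k \<in> \<int>. \<bar>k\<bar> \<le> K})))"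
    by (intro finite_imageI)
      (simp flip: PiE_UNIV_domain add: finite_PiE finite_abs_int_segment)
  moreover have "Z \<subseteq> (\<lambda>f. \<chi> i. f i) ` (Pi UNIV (\<lambda>_ :: 'd. {k \<in> \<int>. \<bar>k\<bar> \<le> K}))"
  proof
    fix z assume "z \<in> Z"
    then show "z \<in> (\<lambda>f. \<chi> i. f i) ` (Pi UNIV (\<lambda>_ :: 'd. {k \<in> \<int>. \<bar>k\<bar> \<le> K}))"
      by (intro image_eqI[of _ _ "\<lambda>i. z $ i"]) (auto simp: Z_def)
  qed
  ultimately have "finite Z"
    by (rule finite_subset[rotated])
  moreover have "\<Phi> \<inter> S \<subseteq> (\<lambda>z. V *v z) ` Z"
  proof
    fix w assume w: "w \<in> \<Phi> \<inter> S"
    then obtain z where z: "w = V *v z" "\<forall>i. z $ i \<in> \<int>"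
      using Phi by auto
    have "B *v w = z"
      by (simp add: z matrix_vector_mul_assoc B)
    then have "\<bar>z $ i\<bar> \<le> K" for i
      using K[of w] w component_le_norm_cart[of z i] by auto
    then show "w \<in> (\<lambda>z. V *v z) ` Z"
      using z by (auto simp: Z_def)
  qed
  ultimately show ?thesis
    by (meson finite_imageI finite_subset)
qed

section \<open>Point group and lattice isometries\<close>

text \<open>An isometry that fixes the origin is linear, so the metric definition of the group can
  be traded for orthogonal maps.\<close>

lemma point_group_iff:
  "f \<in> point_group \<Phi> \<longleftrightarrow> orthogonal_transformation f \<and> f ` \<Phi> = \<Phi>"
  by (auto simp: point_group_def lattice_isometries_def orthogonal_transformation_isometry)

lemma point_group_comp:
  "f \<in> point_group \<Phi> \<Longrightarrow> g \<in> point_group \<Phi> \<Longrightarrow> f \<circ> g \<in> point_group \<Phi>"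
  unfolding point_group_iff by (metis image_comp orthogonal_transformation_compose)

lemma point_group_bij: "f \<in> point_group \<Phi> \<Longrightarrow> bij f"
  by (simp add: point_group_iff orthogonal_transformation_bij)

lemma point_group_inv:
  assumes "f \<in> point_group \<Phi>"
  shows "inv f \<in> point_group \<Phi>"
proof -
  have "inv f ` (f ` \<Phi>) = \<Phi>"
    by (simp add: image_inv_f_f[OF bij_is_inj[OF point_group_bij[OF assms]]])
  then show ?thesis
    using assms by (auto simp: point_group_iff orthogonal_transformation_inv)
qed

lemma id_in_point_group: "id \<in> point_group \<Phi>"
  by (simp add: point_group_iff id_def)

text \<open>A group element is linear, hence determined by its values on the columns of
  \<open>V\<close>, and each column can only go to one of the finitely many lattice points of no
  larger norm. Finiteness matters because \<open>sum\<close> and \<open>card\<close> both return 0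
  on an infinite set, which would trivialize \<open>sym_char\<close>.\<close>

lemma finite_point_group:
  fixes \<Phi> :: "(real ^ 'd) set"
  assumes lat: "is_lattice \<Phi>"
  shows "finite (point_group \<Phi>)"
proof -
  obtain V :: "real ^ 'd ^ 'd" where V: "invertible V"
    and Phi: "\<Phi> = (\<lambda>z. V *v z) ` {z. \<forall>i. z $ i \<in> \<int>}"
    using lat by (auto simp: is_lattice_def)
  define b where "b i = V *v axis i 1" for i
  have b: "b i \<in> \<Phi>" for i
    unfolding b_def Phi by (intro imageI) (auto simp: axis_def)
  define R where "R \<sigma> i = \<sigma> (b i)" for \<sigma> :: "real ^ 'd \<Rightarrow> real ^ 'd" and i
  have "R ` point_group \<Phi> \<subseteq> Pi UNIV (\<lambda>i. \<Phi> \<inter> cball 0 (norm (b i)))"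
    using b by (fastforce simp: R_def point_group_iff orthogonal_transformation_norm)
  moreover have "finite (Pi UNIV (\<lambda>i. \<Phi> \<inter> cball 0 (norm (b i))))"
    by (simp flip: PiE_UNIV_domain add: finite_PiE finite_lattice_Int_bounded[OF lat])
  ultimately have fin: "finite (R ` point_group \<Phi>)"
    by (rule finite_subset)
  have "inj_on R (point_group \<Phi>)"
  proof (rule inj_onI)
    fix \<sigma> \<tau> assume st: "\<sigma> \<in> point_group \<Phi>" "\<tau> \<in> point_group \<Phi>" "R \<sigma> = R \<tau>"
    then have lin: "linear \<sigma>" "linear \<tau>"
      by (auto simp: point_group_iff orthogonal_transformation_linear)
    have "\<sigma> (V *v z) = \<tau> (V *v z)" for z
    proof -
      have lin': "linear (\<lambda>z. \<sigma> (V *v z))" "linear (\<lambda>z. \<tau> (V *v z))"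
        using linear_compose[OF matrix_vector_mul_linear, of _ V] lin by (auto simp: comp_def)
      have "\<sigma> (V *v e) = \<tau> (V *v e)" if "e \<in> Basis" for e
        using that st(3) by (auto simp: Basis_vec_def R_def b_def fun_eq_iff)
      from linear_eq_stdbasis[OF lin' this] show ?thesis
        by (simp add: fun_eq_iff)
    qed
    moreover obtain B where "V ** B = mat 1"
      using V by (auto simp: invertible_def)
    ultimately have "\<sigma> y = \<tau> y" for y
      by (metis matrix_vector_mul_assoc matrix_vector_mul_lid)
    then show "\<sigma> = \<tau>"
      by blast
  qed
  with fin show ?thesis
    by (rule finite_imageD)
qed

text \<open>The origin is a lattice point, so its image is one too, and translating that image back
  to 0 preserves the lattice. Every lattice isometry is thus a point group element followed by a
  lattice translation.\<close>

lemma lattice_isometry_decompose: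
  assumes lat: "is_lattice \<Phi>" and f: "f \<in> lattice_isometries \<Phi>"
  shows "f 0 \<in> \<Phi>" "(\<lambda>y. f y - f 0) \<in> point_group \<Phi>"
proof -
  have im: "f ` \<Phi> = \<Phi>" and iso: "\<And>x y. dist (f x) (f y) = dist x y"
    using f by (auto simp: lattice_isometries_def)
  show f0: "f 0 \<in> \<Phi>"
    using im lattice_zero[OF lat] by blast
  have "(\<lambda>y. f y - f 0) ` \<Phi> = (\<lambda>y. y - f 0) ` (f ` \<Phi>)"
    by (simp add: image_image)
  then have "(\<lambda>y. f y - f 0) ` \<Phi> = \<Phi>"
    by (simp add: im lattice_translate_image[OF lat f0])
  then show "(\<lambda>y. f y - f 0) \<in> point_group \<Phi>"
    using iso by (auto simp: point_group_def lattice_isometries_def dist_norm)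
qed

lemma point_group_dual_lattice:
  assumes "\<sigma> \<in> point_group \<Phi>" "v \<in> dual_lattice \<Phi>"
  shows "\<sigma> v \<in> dual_lattice \<Phi>"
  unfolding dual_lattice_def
proof safe
  fix w assume "w \<in> \<Phi>"
  then obtain u where "u \<in> \<Phi>" "w = \<sigma> u"
    using assms(1) by (auto simp: point_group_iff)
  then show "w \<bullet> \<sigma> v \<in> \<int>"
    using assms by (auto simp: point_group_iff orthogonal_transformation_def dual_lattice_def)
qed

section \<open>Folding coordinates by cosine and arccosine\<close>

text \<open>Composing one reflection at a time reaches every sign pattern; the folding of a point
  needs a pattern that depends on the point.\<close>

lemma sign_change_in_reflection_group:
  fixes A :: "'d::finite set"
  shows "(\<lambda>x :: real ^ 'd. \<chi> i. if i \<in> A then - x $ i else x $ i) \<in> reflection_group"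
proof (induction A rule: finite_induct[OF finite])
  case 1
  have "(\<lambda>x :: real ^ 'd. \<chi> i. if i \<in> {} then - x $ i else x $ i) = id"
    by (auto simp: vec_eq_iff)
  then show ?case
    by (simp add: reflection_group_def generated_group.id del: empty_iff)
next
  case (2 j A)
  have "(\<lambda>x :: real ^ 'd. \<chi> i. if i \<in> insert j A then - x $ i else x $ i)
    = coord_reflection j \<circ> (\<lambda>x. \<chi> i. if i \<in> A then - x $ i else x $ i)"
    using 2 by (auto simp: vec_eq_iff coord_reflection_def fun_eq_iff)
  then show ?case
    using 2
    by (simp add: reflection_group_def generated_group.comp generated_group.base del: insert_iff)
qed

text \<open>The isometry \<open>s\<close> depends on \<open>y\<close> but not on \<open>h\<close>,
  so one choice serves all characters of a series at once. The value type stays polymorphic to cover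
  both the extended real \<open>F\<close> and the complex characters.\<close>

lemma pushdown_change_vars:
  fixes \<Phi> :: "(real ^ 'd) set"
  assumes lat: "is_lattice \<Phi>" and H: "reflection_group \<subseteq> point_group \<Phi>"
    and a: "\<And>i. a $ i > 0" and rect: "rectangular_lattice a \<subseteq> \<Phi>"
  obtains s where "s \<in> lattice_isometries \<Phi>"
    "\<And>h :: real ^ 'd \<Rightarrow> 'b. pushdown a h (change_vars a y) = h (s y)"
proof -
  \<comment> \<open>The integer counts the full turns to remove so that the angle lands between
    \<open>- pi\<close> and \<open>pi\<close>, where \<open>arccos\<close> undoes \<open>cos\<close>
    up to sign.\<close>
  have "\<exists>k::int. arccos (cos (2 * pi * y $ i / a $ i)) = \<bar>2 * pi * y $ i / a $ i - of_int k * (2 * pi)\<bar>"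
    for i
    using arccos_cos_eq_abs_2pi by metis
  then obtain k :: "'d \<Rightarrow> int" where
    k: "\<And>i. arccos (cos (2 * pi * y $ i / a $ i)) = \<bar>2 * pi * y $ i / a $ i - of_int (k i) * (2 * pi)\<bar>"
    by metis
  define w where "w = (\<chi> i. a $ i * of_int (k i))"
  have w: "w \<in> \<Phi>"
    by (rule subsetD[OF rect]) (auto simp: w_def rectangular_lattice_def)
  \<comment> \<open>These are the coordinates in which \<open>y - w\<close> is negative, so that
    \<open>r (y - w)\<close> consists of the absolute values of the coordinates of
    \<open>y - w\<close>.\<close>
  define A where "A = {i. y $ i < w $ i}"
  define r :: "real ^ 'd \<Rightarrow> real ^ 'd" where "r = (\<lambda>x. \<chi> i. if i \<in> A then - x $ i else x $ i)"
  define s where "s x = r (x - w)" for x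
  have r: "r \<in> point_group \<Phi>"
    using H sign_change_in_reflection_group[of A] by (auto simp: r_def)
  have "s ` \<Phi> = r ` ((\<lambda>y. y - w) ` \<Phi>)"
    by (simp add: image_image s_def)
  also have "\<dots> = \<Phi>"
    using r by (simp only: lattice_translate_image[OF lat w] point_group_iff)
  finally have "s \<in> lattice_isometries \<Phi>"
    using r by (auto simp: s_def point_group_def lattice_isometries_def dist_norm)
  moreover have "(\<chi> i. a $ i * arccos (change_vars a y $ i) / (2 * pi)) = s y"
  proof -
    have "a $ i * \<bar>2 * pi * y $ i / a $ i - of_int (k i) * (2 * pi)\<bar> / (2 * pi) = \<bar>y $ i - w $ i\<bar>" for i
    proof -
      have "2 * pi * y $ i / a $ i - of_int (k i) * (2 * pi) = (2 * pi / a $ i) * (y $ i - w $ i)"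
        using a[of i] by (simp add: w_def field_simps)
      then show ?thesis
        using a[of i] by (simp add: abs_mult)
    qed
    then show ?thesis
      by (auto simp: vec_eq_iff change_vars_def k s_def r_def A_def)
  qed
  ultimately show ?thesis
    using that by (simp add: pushdown_def)
qed

section \<open>Symmetrized characters and exponential moments\<close>

lemma exp_eq_cis: "exp (2 * of_real pi * \<i> * of_real t) = cis (2 * pi * t)"
  by (simp add: cis_conv_exp mult_ac)

lemma sym_char_alt:
  "sym_char \<Phi> v y
    = (\<Sum>\<sigma>\<in>point_group \<Phi>. cis (2 * pi * (\<sigma> v \<bullet> y))) / of_nat (card (point_group \<Phi>))"
  by (simp add: sym_char_def exp_eq_cis)

text \<open>The translation part of \<open>f\<close> changes each phase by a multiple of
  \<open>2 * pi\<close>, since \<open>\<sigma> v\<close> stays in the dual lattice. The orthogonal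
  part only permutes the terms of the group sum.\<close>

lemma sym_char_isometry:
  assumes lat: "is_lattice \<Phi>" and f: "f \<in> lattice_isometries \<Phi>" and v: "v \<in> dual_lattice \<Phi>"
  shows "sym_char \<Phi> v (f y) = sym_char \<Phi> v y"
proof -
  define \<rho> where "\<rho> y = f y - f 0" for y
  have \<rho>: "\<rho> \<in> point_group \<Phi>" and f0: "f 0 \<in> \<Phi>"
    using lattice_isometry_decompose[OF lat f] by (auto simp: \<rho>_def[abs_def])
  have "(\<Sum>\<sigma>\<in>point_group \<Phi>. cis (2 * pi * (\<sigma> v \<bullet> f y)))
      = (\<Sum>\<sigma>\<in>point_group \<Phi>. cis (2 * pi * (\<sigma> v \<bullet> \<rho> y)))"
  proof (rule sum.cong[OF refl])
    fix \<sigma> assume "\<sigma> \<in> point_group \<Phi>"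
    from point_group_dual_lattice[OF this v] f0 have "\<sigma> v \<bullet> f 0 \<in> \<int>"
      by (auto simp: dual_lattice_def inner_commute)
    then have "cis (2 * pi * (\<sigma> v \<bullet> f 0)) = 1"
      by (rule cis_multiple_2pi)
    moreover have "2 * pi * (\<sigma> v \<bullet> f y) = 2 * pi * (\<sigma> v \<bullet> \<rho> y) + 2 * pi * (\<sigma> v \<bullet> f 0)"
      by (simp add: \<rho>_def inner_diff_right algebra_simps)
    ultimately show "cis (2 * pi * (\<sigma> v \<bullet> f y)) = cis (2 * pi * (\<sigma> v \<bullet> \<rho> y))"
      by (simp flip: cis_mult)
  qed
  also have "\<dots> = (\<Sum>\<sigma>\<in>point_group \<Phi>. cis (2 * pi * (\<sigma> v \<bullet> y)))"
  \<comment> \<open>Orthogonality moves \<open>\<rho>\<close> from \<open>y\<close> to the other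
    factor as its inverse, and left multiplication by \<open>inv \<rho>\<close> is a bijection of
    the group.\<close>
  proof (rule sum.reindex_bij_witness[where i = "\<lambda>\<sigma>. \<rho> \<circ> \<sigma>" and j = "\<lambda>\<sigma>. inv \<rho> \<circ> \<sigma>"])
    fix \<sigma> assume \<sigma>: "\<sigma> \<in> point_group \<Phi>"
    show "\<rho> \<circ> (inv \<rho> \<circ> \<sigma>) = \<sigma>" "inv \<rho> \<circ> (\<rho> \<circ> \<sigma>) = \<sigma>"
      using point_group_bij[OF \<rho>] by (auto simp: fun_eq_iff surj_f_inv_f bij_is_surj bij_is_inj)
    show "inv \<rho> \<circ> \<sigma> \<in> point_group \<Phi>" "\<rho> \<circ> \<sigma> \<in> point_group \<Phi>"
      using \<rho> \<sigma> by (auto intro: point_group_comp point_group_inv)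
    have "inv \<rho> (\<sigma> v) \<bullet> y = \<rho> (inv \<rho> (\<sigma> v)) \<bullet> \<rho> y"
      using \<rho> by (simp add: point_group_iff orthogonal_transformation_def)
    also have "\<rho> (inv \<rho> (\<sigma> v)) = \<sigma> v"
      using point_group_bij[OF \<rho>] by (metis bij_inv_eq_iff)
    finally show "cis (2 * pi * ((inv \<rho> \<circ> \<sigma>) v \<bullet> y)) = cis (2 * pi * (\<sigma> v \<bullet> \<rho> y))"
      by simp
  qed
  finally show ?thesis
    by (simp add: sym_char_alt)
qed

text \<open>An average of unit complex numbers; the bound lets \<open>c\<close> dominate the series
  for \<open>g\<close>.\<close>

lemma norm_sym_char_le_1: "norm (sym_char \<Phi> v y) \<le> 1"
proof -
  have "norm (\<Sum>\<sigma>\<in>point_group \<Phi>. cis (2 * pi * (\<sigma> v \<bullet> y))) \<le> real (card (point_group \<Phi>))"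
    by (rule order_trans[OF norm_sum]) simp
  then show ?thesis
    by (simp add: sym_char_alt norm_divide divide_le_eq)
qed

text \<open>The character of a difference is a product of one character value and the conjugate of
  another, so the double sum, diagonal included, is the moment times its conjugate.\<close>

lemma exp_moment_norm_square:
  "(\<Sum>i\<in>{1..n}. \<Sum>j\<in>{1..n}. cis (2 * pi * (v \<bullet> (x i - x j)))) = of_real ((norm (exp_moment v n x))\<^sup>2)"
proof -
  have "cis (2 * pi * (v \<bullet> (x i - x j))) = cis (2 * pi * (v \<bullet> x i)) * cnj (cis (2 * pi * (v \<bullet> x j)))" for i j
    by (simp add: cis_cnj cis_mult inner_diff_right algebra_simps)
  then show ?thesis
    unfolding complex_norm_square exp_moment_def exp_eq_cis cnj_sum
    by (simp add: sum_product)
qed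

text \<open>This is the positive definiteness of the symmetrized characters, in the quantitative
  form that the equality case requires.\<close>

lemma sum_sym_char_differences:
  "(\<Sum>i\<in>{1..n}. \<Sum>j\<in>{1..n}. sym_char \<Phi> v (x i - x j))
    = of_real ((\<Sum>\<sigma>\<in>point_group \<Phi>. (norm (exp_moment (\<sigma> v) n x))\<^sup>2) / card (point_group \<Phi>))"
proof -
  have "(\<Sum>i\<in>{1..n}. \<Sum>j\<in>{1..n}. \<Sum>\<sigma>\<in>point_group \<Phi>. cis (2 * pi * (\<sigma> v \<bullet> (x i - x j))))
      = (\<Sum>i\<in>{1..n}. \<Sum>\<sigma>\<in>point_group \<Phi>. \<Sum>j\<in>{1..n}. cis (2 * pi * (\<sigma> v \<bullet> (x i - x j))))"
    by (intro sum.cong refl sum.swap)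
  also have "\<dots> = (\<Sum>\<sigma>\<in>point_group \<Phi>. \<Sum>i\<in>{1..n}. \<Sum>j\<in>{1..n}. cis (2 * pi * (\<sigma> v \<bullet> (x i - x j))))"
    by (rule sum.swap)
  also have "\<dots> = of_real (\<Sum>\<sigma>\<in>point_group \<Phi>. (norm (exp_moment (\<sigma> v) n x))\<^sup>2)"
    by (simp only: exp_moment_norm_square of_real_sum)
  finally show ?thesis
    by (simp add: sym_char_alt flip: sum_divide_distrib)
qed

section \<open>Finite sums of series and of extended reals\<close>

lemma has_sum_sum:
  fixes f :: "'i \<Rightarrow> 'a \<Rightarrow> 'b::topological_comm_monoid_add"
  assumes "\<And>i. i \<in> I \<Longrightarrow> (f i has_sum s i) A"
  shows "((\<lambda>v. \<Sum>i\<in>I. f i v) has_sum (\<Sum>i\<in>I. s i)) A"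
  using assms by (induction I rule: infinite_finite_induct) (auto intro: has_sum_add)

text \<open>The real lower bounds exclude minus infinity and a finite total excludes plus infinity,
  so in the equality case the claim reduces to its real counterpart.\<close>

lemma sum_ereal_mono_eq_iff:
  fixes f :: "'i \<Rightarrow> ereal"
  assumes "finite I" "\<And>i. i \<in> I \<Longrightarrow> ereal (g i) \<le> f i"
  shows "(\<Sum>i\<in>I. f i) = ereal (\<Sum>i\<in>I. g i) \<longleftrightarrow> (\<forall>i\<in>I. f i = ereal (g i))"
proof
  assume eq: "(\<Sum>i\<in>I. f i) = ereal (\<Sum>i\<in>I. g i)"
  have "f i \<noteq> \<infinity>" if "i \<in> I" for i
    using eq sum_Pinfty[of f I] assms(1) that by auto
  then have f: "f i = ereal (real_of_ereal (f i))" if "i \<in> I" for i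
    using assms(2)[OF that] that by (cases "f i") auto
  then have "(\<Sum>i\<in>I. f i) = ereal (\<Sum>i\<in>I. real_of_ereal (f i))"
    by (simp flip: sum_ereal)
  with eq have sums: "(\<Sum>i\<in>I. g i) = (\<Sum>i\<in>I. real_of_ereal (f i))"
    by simp
  have "g i \<le> real_of_ereal (f i)" if "i \<in> I" for i
    using assms(2)[OF that] f[OF that] by (metis ereal_less_eq(3))
  from sum_mono_inv[OF sums this _ assms(1)] f show "\<forall>i\<in>I. f i = ereal (g i)"
    by metis
qed simp

section \<open>Energy comparison, lower bound and equality cases\<close>

theorem theorem12:
  fixes \<Phi> W \<Delta> :: "(real ^ 'd) set"
    and F :: "real ^ 'd \<Rightarrow> ereal"
    and a :: "real ^ 'd"
    and c :: "real ^ 'd \<Rightarrow> real"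
    and n :: nat
    and x :: "nat \<Rightarrow> real ^ 'd"
  defines "T \<equiv> change_vars a"
    and "gt \<equiv> poly_series \<Phi> a W c"
    and "Ft \<equiv> pushdown a F"
  defines "g \<equiv> gt \<circ> T"
  assumes "is_lattice \<Phi>"
    and "reflection_group \<subseteq> point_group \<Phi>"
    and "\<And>y. F y \<noteq> -\<infinity>"
    and "\<And>\<sigma> y. \<sigma> \<in> lattice_isometries \<Phi> \<Longrightarrow> F (\<sigma> y) = F y"
    and "\<And>i. a $ i > 0"
    and "rectangular_lattice a \<subseteq> \<Phi>"
    and "fundamental_domain (point_group \<Phi>) (dual_lattice \<Phi>) W"
    and "fundamental_domain (lattice_isometries \<Phi>) UNIV \<Delta>"
    and "\<And>v. v \<in> W - {0} \<Longrightarrow> c v \<ge> 0"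
    and "c summable_on W"
    and "\<And>t. t \<in> T ` \<Delta> \<Longrightarrow> ereal (gt t) \<le> Ft t"
  shows "energy F n x \<ge> ereal (energy g n x)
    \<and> energy g n x \<ge> (real n)\<^sup>2 * c 0 - real n * gt (\<chi> i. 1)
    \<and> ((energy F n x = ereal (energy g n x)
         \<and> energy g n x = (real n)\<^sup>2 * c 0 - real n * gt (\<chi> i. 1))
       \<longleftrightarrow>
        ((\<forall>t \<in> T ` {x i - x j | i j. i \<in> {1..n} \<and> j \<in> {1..n} \<and> i \<noteq> j}. ereal (gt t) = Ft t)
         \<and> (\<forall>v \<in> W - {0}. \<forall>\<sigma> \<in> point_group \<Phi>. complex_of_real (c v) * exp_moment (\<sigma> v) n x = 0)))"
proof -
  note lat = assms(5) and H = assms(6) and F_inv = assms(8) and a = assms(9) and rect = assms(10)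
    and W = assms(11) and \<Delta> = assms(12) and c_nonneg = assms(13) and c_sum = assms(14)
    and le = assms(15)
  let ?G = "point_group \<Phi>" and ?N = "{1..n}"
  have W_dual: "v \<in> dual_lattice \<Phi>" if "v \<in> W" for v
    using W that by (auto simp: fundamental_domain_def)
  have c_sum': "c summable_on (W - {0})"
    using c_sum by (rule summable_on_subset_banach) auto
  have G0: "card ?G > 0"
    using finite_point_group[OF lat] id_in_point_group card_gt_0_iff by blast

  have Ft_T: "Ft (T y) = F y" for y
  proof -
    obtain s where "s \<in> lattice_isometries \<Phi>" "\<And>h :: real ^ 'd \<Rightarrow> ereal. pushdown a h (change_vars a y) = h (s y)"
      using pushdown_change_vars[OF lat H a rect] by metis
    then show ?thesis
      by (simp add: Ft_def T_def F_inv)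
  qed
  have g_eq: "g y = c 0 + (\<Sum>\<^sub>\<infinity>v\<in>W - {0}. c v * Re (sym_char \<Phi> v y))" for y
  proof -
    obtain s where s: "s \<in> lattice_isometries \<Phi>" "\<And>h :: real ^ 'd \<Rightarrow> complex. pushdown a h (change_vars a y) = h (s y)"
      using pushdown_change_vars[OF lat H a rect] by metis
    have "lattice_poly \<Phi> a v (T y) = sym_char \<Phi> v y" if "v \<in> W - {0}" for v
      using that by (simp add: lattice_poly_def T_def s sym_char_isometry[OF lat s(1) W_dual])
    then have "(\<Sum>\<^sub>\<infinity>v\<in>W - {0}. c v * Re (lattice_poly \<Phi> a v (T y)))
        = (\<Sum>\<^sub>\<infinity>v\<in>W - {0}. c v * Re (sym_char \<Phi> v y))"
      by (intro infsum_cong) simp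
    then show ?thesis
      by (simp add: g_def gt_def poly_series_def)
  qed
  have g_inv: "g (s y) = g y" if "s \<in> lattice_isometries \<Phi>" for s y
    unfolding g_eq using that
    by (intro arg_cong2[where f = "(+)"] infsum_cong) (auto simp: sym_char_isometry[OF lat _ W_dual])
  \<comment> \<open>The comparison is assumed only on the image of \<open>\<Delta>\<close>;
    invariance of both functions carries it to the whole space by moving \<open>y\<close> into
    \<open>\<Delta>\<close>.\<close>
  have g_le_F: "ereal (g y) \<le> F y" for y
  proof -
    obtain s where s: "s \<in> lattice_isometries \<Phi>" "s y \<in> \<Delta>"
      using \<Delta> unfolding fundamental_domain_def by blast
    have "ereal (g (s y)) \<le> F (s y)"
      using le[of "T (s y)"] s by (simp add: Ft_T g_def)
    then show ?thesis
      by (simp add: s g_inv F_inv)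
  qed
  have g_0: "g 0 = gt (\<chi> i. 1)"
    by (simp add: g_def T_def change_vars_def)

  define S where "S v = (\<Sum>\<sigma>\<in>?G. (norm (exp_moment (\<sigma> v) n x))\<^sup>2)" for v
  have S_nonneg: "S v \<ge> 0" for v
    by (simp add: S_def sum_nonneg)
  \<comment> \<open>The contribution of \<open>v\<close> to the sum of \<open>g\<close> over all
    ordered pairs, diagonal included.\<close>
  define D where "D v = c v * (S v / card ?G)" for v
  have D_nonneg: "D v \<ge> 0" if "v \<in> W - {0}" for v
    using c_nonneg[OF that] S_nonneg by (simp add: D_def)
  have "((\<lambda>v. c v * Re (sym_char \<Phi> v y)) has_sum g y - c 0) (W - {0})" for y
  proof -
    \<comment> \<open>Absolute convergence at each \<open>y\<close>, by comparison with the summable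
      family \<open>c\<close>.\<close>
    have "(\<lambda>v. norm (c v * Re (sym_char \<Phi> v y))) summable_on (W - {0})"
    proof (rule summable_on_comparison_test[OF c_sum'])
      fix v assume v: "v \<in> W - {0}"
      have "\<bar>Re (sym_char \<Phi> v y)\<bar> \<le> 1"
        using abs_Re_le_cmod norm_sym_char_le_1 order_trans by blast
      then show "norm (c v * Re (sym_char \<Phi> v y)) \<le> c v"
        using c_nonneg[OF v] by (simp add: abs_mult mult_left_le)
    qed simp
    from has_sum_infsum[OF Infinite_Sum.abs_summable_summable[OF this]] show ?thesis
      by (simp add: g_eq)
  qed
  then have "((\<lambda>v. \<Sum>i\<in>?N. \<Sum>j\<in>?N. c v * Re (sym_char \<Phi> v (x i - x j)))
      has_sum (\<Sum>i\<in>?N. \<Sum>j\<in>?N. g (x i - x j) - c 0)) (W - {0})"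
    by (intro has_sum_sum)
  moreover have "(\<Sum>i\<in>?N. \<Sum>j\<in>?N. c v * Re (sym_char \<Phi> v (x i - x j))) = D v" for v
  proof -
    have "(\<Sum>i\<in>?N. \<Sum>j\<in>?N. c v * Re (sym_char \<Phi> v (x i - x j)))
        = c v * Re (\<Sum>i\<in>?N. \<Sum>j\<in>?N. sym_char \<Phi> v (x i - x j))"
      by (simp add: sum_distrib_left)
    then show ?thesis
      by (simp only: sum_sym_char_differences Re_complex_of_real D_def S_def)
  qed
  \<comment> \<open>The energy omits the diagonal pairs; adding them back costs \<open>n\<close>
    copies of \<open>g 0\<close>, the origin of the subtracted term in the lower bound.\<close>
  moreover have "(\<Sum>i\<in>?N. \<Sum>j\<in>?N. g (x i - x j)) = energy g n x + real n * g 0"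
  proof -
    have "(\<Sum>j\<in>?N. g (x i - x j)) = g 0 + (\<Sum>j\<in>?N - {i}. g (x i - x j))" if "i \<in> ?N" for i
      using that by (simp add: sum.remove)
    then have "(\<Sum>i\<in>?N. \<Sum>j\<in>?N. g (x i - x j))
        = (\<Sum>i\<in>?N. g 0 + (\<Sum>j\<in>?N - {i}. g (x i - x j)))"
      by (rule sum.cong[OF refl])
    then show ?thesis
      by (simp add: energy_def sum.distrib)
  qed
  \<comment> \<open>Each of the \<open>n * n\<close> ordered pairs gives up one \<open>c 0\<close>,
    so the series sums exactly to the gap in the second inequality.\<close>
  ultimately have D_sum: "(D has_sum energy g n x - ((real n)\<^sup>2 * c 0 - real n * g 0)) (W - {0})"
    by (simp add: sum_subtractf power2_eq_square algebra_simps)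
  have lower: "energy g n x \<ge> (real n)\<^sup>2 * c 0 - real n * g 0"
    using has_sum_nonneg[OF D_sum D_nonneg] by simp
  have "energy g n x = (real n)\<^sup>2 * c 0 - real n * g 0 \<longleftrightarrow> (\<forall>v\<in>W - {0}. D v = 0)"
  proof
    assume "energy g n x = (real n)\<^sup>2 * c 0 - real n * g 0"
    then show "\<forall>v\<in>W - {0}. D v = 0"
      using nonneg_has_sum_le_0D[OF D_sum _ D_nonneg] by simp
  next
    assume "\<forall>v\<in>W - {0}. D v = 0"
    then have "(D has_sum 0) (W - {0})"
      by (intro has_sum_0) auto
    from has_sum_unique[OF D_sum this] show "energy g n x = (real n)\<^sup>2 * c 0 - real n * g 0"
      by simp
  qed
  \<comment> \<open>As the group has positive cardinality, \<open>D v = 0\<close> forces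
    \<open>c v = 0\<close> or a vanishing sum of squares, hence vanishing moments along the whole
    orbit of \<open>v\<close>.\<close>
  also have "\<dots> \<longleftrightarrow> (\<forall>v \<in> W - {0}. \<forall>\<sigma> \<in> ?G. complex_of_real (c v) * exp_moment (\<sigma> v) n x = 0)"
    using G0 by (auto simp: D_def S_def sum_nonneg_eq_0_iff finite_point_group[OF lat])
  finally have lower_eq: "energy g n x = (real n)\<^sup>2 * c 0 - real n * g 0 \<longleftrightarrow>
    (\<forall>v \<in> W - {0}. \<forall>\<sigma> \<in> ?G. complex_of_real (c v) * exp_moment (\<sigma> v) n x = 0)" .

  \<comment> \<open>Flattening the off-diagonal double sum to a single index set makes the equality
    criterion for one finite sum applicable.\<close>
  let ?P = "Sigma ?N (\<lambda>i. ?N - {i})"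
  have energy_pairs: "energy f n x = (\<Sum>(i, j)\<in>?P. f (x i - x j))"
    for f :: "real ^ 'd \<Rightarrow> 'b::comm_monoid_add"
    by (simp add: energy_def sum.Sigma)
  have upper: "energy F n x \<ge> ereal (energy g n x)"
    unfolding energy_def sum_ereal[symmetric] by (intro sum_mono g_le_F)
  have "energy F n x = ereal (energy g n x) \<longleftrightarrow> (\<forall>(i, j)\<in>?P. F (x i - x j) = ereal (g (x i - x j)))"
    using sum_ereal_mono_eq_iff[of ?P "\<lambda>(i, j). g (x i - x j)" "\<lambda>(i, j). F (x i - x j)"] g_le_F
    by (auto simp: energy_pairs)
  \<comment> \<open>At a point \<open>T y\<close> the two sides are \<open>g y\<close> and
    \<open>F y\<close>, so the condition on the image of \<open>T\<close> is the condition on each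
    off-diagonal pair.\<close>
  also have "\<dots> \<longleftrightarrow> (\<forall>t \<in> T ` {x i - x j | i j. i \<in> ?N \<and> j \<in> ?N \<and> i \<noteq> j}. ereal (gt t) = Ft t)"
    by (fastforce simp: Ft_T g_def)
  finally show ?thesis
    using upper lower lower_eq by (simp only: g_0)
qed

end
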